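(* For $a \in \mathbb{N}\setminus\{0\}$, the Chebyshev plane curve $\mathcal{X}_{a,a+1,T} \subset \mathbb{C}^2$ is hyperbolic with respect to the origin. That is, any real line passing through the origin intersects the curve $\mathcal{X}_{a,a+1,T}$ in $\deg(\mathcal{X}_{a,a+1,T}) = a+1$ real points, counting multiplicities.
   Context: The Chebyshev polynomials of the first kind are defined by $T_0(t)=1$, $T_1(t)=t$, $T_{k+1}(t)=2t\,T_k(t)-T_{k-1}(t)$. For $a,b\in\mathbb{N}$, $\mathcal{X}_{a,b,T}\subset\mathbb{C}^2$ denotes the Zariski closure of the image of the map $\mathbb{C}\to\mathbb{C}^2$, $t\mapsto (T_a(t),T_b(t))$; coordinates on $\mathbb{C}^2$ are $(x,y)$. A real line through the origin is a line $\{\alpha x-\beta y=0\}$ with $(\alpha,\beta)\in\mathbb{R}^2\setminus\{(0,0)\}$.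
   Formalization: The line x = 0 meets the curve in C² in only a points (for a = 1, y = 2x² − 1 is met once), so intersections are counted on the projective closure, including the point at infinity; for every other real line through the origin the count in C² is also proved. *)

theory Defs
  imports "HOL-Analysis.Analysis" "HOL-Computational_Algebra.Polynomial"
begin

fun chebyshev_T :: "nat \<Rightarrow> complex poly" where
  "chebyshev_T 0 = 1"
| "chebyshev_T (Suc 0) = [:0, 1:]"
| "chebyshev_T (Suc (Suc k)) = [:0, 2:] * chebyshev_T (Suc k) - chebyshev_T k"

text \<open>An element \<open>F\<close> of \<open>complex poly poly\<close> stands for a polynomial in \<open>x\<close> and \<open>y\<close>: the inner
  variable is \<open>x\<close>, the outer one is \<open>y\<close>, so \<open>coeff (coeff F j) i\<close> is the coefficient of
  \<open>x ^ i * y ^ j\<close>.\<close>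

definition eval2 :: "complex poly poly \<Rightarrow> complex \<Rightarrow> complex \<Rightarrow> complex" where
  "eval2 F x y = poly (poly F [:y:]) x"

definition total_degree :: "complex poly poly \<Rightarrow> nat" where
  "total_degree F = Max (insert 0 {i + j |i j. coeff (coeff F j) i \<noteq> 0})"

definition vanishing_ideal :: "(complex \<times> complex) set \<Rightarrow> complex poly poly set" where
  "vanishing_ideal S = {F. \<forall>(x, y)\<in>S. eval2 F x y = 0}"

definition zariski_closure :: "(complex \<times> complex) set \<Rightarrow> (complex \<times> complex) set" where
  "zariski_closure S = {(x, y). \<forall>F\<in>vanishing_ideal S. eval2 F x y = 0}"

definition chebyshev_curve :: "nat \<Rightarrow> nat \<Rightarrow> (complex \<times> complex) set" where
  "chebyshev_curve a b =
     zariski_closure (range (\<lambda>t. (poly (chebyshev_T a) t, poly (chebyshev_T b) t)))"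

text \<open>The vanishing ideal of a plane curve is principal. Its generator is unique up to a
  nonzero constant factor, on which nothing below depends.\<close>

definition defining_poly :: "(complex \<times> complex) set \<Rightarrow> complex poly poly" where
  "defining_poly X = (SOME F. vanishing_ideal X = {G. F dvd G})"

definition curve_degree :: "(complex \<times> complex) set \<Rightarrow> nat" where
  "curve_degree X = total_degree (defining_poly X)"

text \<open>The value at \<open>(x, y, z)\<close> of the homogenization of \<open>F\<close>, in a ring into which the
  coefficients are mapped by \<open>\<iota>\<close>. Subtraction truncates only where the coefficient is zero.\<close>

definition homogenization ::
  "(complex \<Rightarrow> 'r::comm_ring_1) \<Rightarrow> complex poly poly \<Rightarrow> 'r \<Rightarrow> 'r \<Rightarrow> 'r \<Rightarrow> 'r" where
  "homogenization \<iota> F x y z =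
     (\<Sum>j\<le>degree F. \<Sum>i\<le>degree (coeff F j).
        \<iota> (coeff (coeff F j) i) * x ^ i * y ^ j * z ^ (total_degree F - i - j))"

text \<open>A point of the complex projective plane is the set of its homogeneous coordinate
  vectors; \<open>(x, y)\<close> in the affine plane is identified with \<open>[x : y : 1]\<close>.\<close>

definition proj_point :: "complex ^ 3 \<Rightarrow> (complex ^ 3) set" where
  "proj_point v = {c *s v |c. c \<noteq> 0}"

definition proj_plane :: "(complex ^ 3) set set" where
  "proj_plane = proj_point ` {v. v \<noteq> 0}"

definition real_proj_point :: "(complex ^ 3) set \<Rightarrow> bool" where
  "real_proj_point P \<longleftrightarrow> (\<exists>v\<in>P. \<forall>i. v $ i \<in> \<real>)"

definition affine_point :: "complex \<times> complex \<Rightarrow> (complex ^ 3) set" where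
  "affine_point = (\<lambda>(x, y). proj_point (vector [x, y, 1]))"

definition proj_closure :: "(complex \<times> complex) set \<Rightarrow> (complex ^ 3) set set" where
  "proj_closure X =
     {P \<in> proj_plane. \<forall>v\<in>P. homogenization id (defining_poly X) (v $ 1) (v $ 2) (v $ 3) = 0}"

definition line_through_origin :: "real \<Rightarrow> real \<Rightarrow> (complex \<times> complex) set" where
  "line_through_origin \<alpha> \<beta> = {(x, y). of_real \<alpha> * x - of_real \<beta> * y = 0}"

definition proj_line_through_origin :: "real \<Rightarrow> real \<Rightarrow> (complex ^ 3) set set" where
  "proj_line_through_origin \<alpha> \<beta> =
     {P \<in> proj_plane. \<forall>v\<in>P. of_real \<alpha> * v $ 1 - of_real \<beta> * v $ 2 = 0}"

text \<open>Intersection multiplicity at a point \<open>P\<close> of a projective line \<open>L\<close>: the order of vanishing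
  at \<open>s = 0\<close> of the homogenized equation restricted to \<open>L\<close>, parametrized as \<open>s \<mapsto> v + s w\<close> with
  \<open>v\<close> representing \<open>P\<close> and \<open>w\<close> representing another point of \<open>L\<close>. The order does not depend on
  the choice of \<open>v\<close> and \<open>w\<close>. It is unspecified if \<open>L\<close> is a component of the curve.\<close>

definition intersection_mult ::
  "(complex \<times> complex) set \<Rightarrow> (complex ^ 3) set set \<Rightarrow> (complex ^ 3) set \<Rightarrow> nat" where
  "intersection_mult X L P =
     (let (v, w) = (SOME (v, w). v \<in> P \<and> w \<in> \<Union> (L - {P}))
      in order 0 (homogenization (\<lambda>c. [:c:]) (defining_poly X)
           [:v $ 1, w $ 1:] [:v $ 2, w $ 2:] [:v $ 3, w $ 3:]))"

text \<open>Intersections are counted on the projective closure. For \<open>chebyshev_curve a (a + 1)\<close> this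
  matters only for the line \<open>x = 0\<close>, which passes through the point at infinity of the curve: the
  parabola \<open>y = 2 * x\<^sup>2 - 1\<close>, for \<open>a = 1\<close>, meets it in one affine point only.\<close>

definition hyperbolic_wrt_origin :: "(complex \<times> complex) set \<Rightarrow> bool" where
  "hyperbolic_wrt_origin X \<longleftrightarrow>
     (\<forall>\<alpha> \<beta>. (\<alpha>, \<beta>) \<noteq> (0, 0) \<longrightarrow>
        (let L = proj_line_through_origin \<alpha> \<beta>;
             R = {P \<in> L \<inter> proj_closure X. real_proj_point P}
         in finite R \<and> (\<Sum>P\<in>R. intersection_mult X L P) = curve_degree X))"

end

theory Submission
  imports Defs "HOL-Computational_Algebra.Fundamental_Theorem_Algebra" "HOL-Number_Theory.Cong"
begin

text \<open>Write \<open>T k\<close> for \<open>chebyshev_T k\<close> and let \<open>F = T b (x) - T a (y)\<close>, where \<open>b = a + 1\<close>. The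
  semigroup law \<open>T a \<circ> T b = T b \<circ> T a\<close> puts \<open>F\<close> into the vanishing ideal of the curve; two facts
  make it a complete description. First, the zeros of \<open>F\<close> are exactly the points \<open>(T a t, T b t)\<close>:
  after the substitution \<open>t = cos \<theta>\<close> this is a computation with the periods of cosine
  (\<open>chebyshev_eq_zero_imp_image\<close>). Secondly, \<open>F\<close> generates the ideal
  (\<open>vanishing_ideal_chebyshev_curve\<close>): the remainder of a division by \<open>F\<close> has degree less than \<open>a\<close>
  in \<open>y\<close>, and pulled back along \<open>t \<mapsto> (T a t, T b t)\<close> its terms \<open>r j (x) * y ^ j\<close> have degrees that
  are pairwise incongruent modulo \<open>a\<close>, so that nothing can cancel. The total degree of \<open>F\<close> is
  \<open>a + 1\<close>.

  For hyperbolicity, restrict \<open>F\<close> to the line of the points \<open>(\<beta> r, \<alpha> r)\<close>. The result is a polynomial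
  \<open>f\<close> in \<open>r\<close>, and over the complex numbers its roots, counted with multiplicity, account for all
  intersections at finite distance; the point at infinity accounts for the difference between the
  total degree and the degree of \<open>f\<close> (\<open>hyperbolic_on_line\<close>). So multiplicities take care of
  themselves as soon as all complex roots of \<open>f\<close> are real. If \<open>f r = 0\<close>, then
  \<open>(\<beta> r, \<alpha> r) = (T a t, T b t)\<close> for some complex \<open>t\<close>, hence \<open>\<alpha> T a t = \<beta> T (a + 1) t\<close>. Consecutive
  Chebyshev polynomials satisfy the identity \<open>Im (T (k + 1) t * cnj (T k t)) = Im t * s\<close> with
  \<open>s > 0\<close> (\<open>Im_chebyshev_T_mult_cnj\<close>), which forbids such a relation for nonreal \<open>t\<close>. So \<open>t\<close> is real,
  and so is \<open>r\<close>.\<close>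

section \<open>Chebyshev polynomials\<close>

lemma poly_chebyshev_T_rec:
  "poly (chebyshev_T (Suc (Suc k))) t = 2 * t * poly (chebyshev_T (Suc k)) t - poly (chebyshev_T k) t"
  by (simp add: algebra_simps)

lemma poly_chebyshev_T_cos: "poly (chebyshev_T k) (cos z) = cos (of_nat k * z)"
proof (induction k rule: chebyshev_T.induct)
  case (3 k)
  have "cos (of_nat (Suc (Suc k)) * z) + cos (of_nat k * z) = 2 * cos z * cos (of_nat (Suc k) * z)"
    using cos_add[of "of_nat (Suc k) * z" z] cos_diff[of "of_nat (Suc k) * z" z]
    by (simp add: algebra_simps)
  with 3 show ?case
    by (simp only: poly_chebyshev_T_rec) (simp add: algebra_simps)
qed auto

lemma degree_chebyshev_T: "degree (chebyshev_T k) = k"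
proof -
  have "degree (chebyshev_T k) = k \<and> degree (chebyshev_T (Suc k)) = Suc k"
  proof (induction k)
    case (Suc k)
    have nz: "chebyshev_T (Suc k) \<noteq> 0"
      using Suc by auto
    have "degree ([:0, 2:] * chebyshev_T (Suc k)) = Suc (Suc k)"
      using Suc nz by (subst degree_mult_eq) auto
    with Suc have "degree (chebyshev_T (Suc (Suc k))) = Suc (Suc k)"
      unfolding chebyshev_T.simps diff_conv_add_uminus by (subst degree_add_eq_left) auto
    with Suc show ?case by blast
  qed auto
  then show ?thesis ..
qed

lemma chebyshev_T_nonzero: "chebyshev_T k \<noteq> 0"
proof (cases "k = 0")
  case False
  then show ?thesis
    by (metis degree_chebyshev_T degree_0)
qed simp

text \<open>Multiplying the recurrence by the conjugate of \<open>T (k + 1) t\<close> and taking imaginary parts increases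
  the factor \<open>s\<close> by \<open>2 * (cmod (T (k + 1) t))\<^sup>2\<close>, starting from \<open>s = 1\<close>. In other words, the quotient
  \<open>T (k + 1) / T k\<close> maps the upper half-plane into itself and has no zero or pole there.\<close>

lemma Im_chebyshev_T_mult_cnj:
  "\<exists>s>0. Im (poly (chebyshev_T (Suc k)) t * cnj (poly (chebyshev_T k) t)) = Im t * s"
proof (induction k)
  case 0
  show ?case by (intro exI[of _ 1]) simp
next
  case (Suc k)
  then obtain s where s: "s > 0"
    "Im (poly (chebyshev_T (Suc k)) t * cnj (poly (chebyshev_T k) t)) = Im t * s"
    by blast
  define u v where "u = poly (chebyshev_T (Suc k)) t" and "v = poly (chebyshev_T k) t"
  have "Im ((2 * t * u - v) * cnj u) = Im t * (2 * (cmod u)\<^sup>2) + Im (u * cnj v)"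
    unfolding cmod_power2 by (simp add: power2_eq_square algebra_simps)
  also have "\<dots> = Im t * (2 * (cmod u)\<^sup>2 + s)"
    using s by (simp add: u_def v_def algebra_simps)
  finally have "Im (poly (chebyshev_T (Suc (Suc k))) t * cnj (poly (chebyshev_T (Suc k)) t))
      = Im t * (2 * (cmod u)\<^sup>2 + s)"
    unfolding poly_chebyshev_T_rec u_def v_def by (simp add: algebra_simps)
  moreover have "2 * (cmod u)\<^sup>2 + s > 0"
    using s(1) by (simp add: add_nonneg_pos)
  ultimately show ?case by blast
qed

text \<open>For nonreal \<open>t\<close> the quotient \<open>T (k + 1) t / T k t\<close> is nonreal, whereas the relation would make it
  real, zero or infinite. The case \<open>\<beta> = 0\<close> is the reality of the roots of \<open>T k\<close>.\<close>

lemma real_chebyshev_pencil_root: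
  fixes \<alpha> \<beta> :: real
  assumes "(\<alpha>, \<beta>) \<noteq> (0, 0)"
    and "of_real \<alpha> * poly (chebyshev_T k) t = of_real \<beta> * poly (chebyshev_T (Suc k)) t"
  shows "t \<in> \<real>"
proof -
  define u v where "u = poly (chebyshev_T (Suc k)) t" and "v = poly (chebyshev_T k) t"
  have eq: "of_real \<alpha> * v = of_real \<beta> * u"
    using assms(2) by (simp add: u_def v_def)
  have "Im (u * cnj v) = 0"
  proof (cases "\<beta> = 0")
    case True
    then show ?thesis using eq assms(1) by simp
  next
    case False
    then have "u = of_real (\<alpha> / \<beta>) * v"
      using eq by (simp add: field_simps)
    then have "u * cnj v = of_real (\<alpha> / \<beta>) * (v * cnj v)"
      by simp
    then show ?thesis
      by (simp add: complex_mult_cnj)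
  qed
  then have "Im t = 0"
    using Im_chebyshev_T_mult_cnj[of k t] by (auto simp: u_def v_def)
  then show ?thesis by (simp add: complex_is_Real_iff)
qed

lemma real_poly_chebyshev_T: "t \<in> \<real> \<Longrightarrow> poly (chebyshev_T k) t \<in> \<real>"
  by (induction k rule: chebyshev_T.induct) (auto intro: Reals_mult Reals_diff)


section \<open>Bivariate polynomials\<close>

text \<open>The image of \<open>G\<close> under the ring homomorphism that sends \<open>x\<close> to \<open>A\<close> and \<open>y\<close> to \<open>B\<close>, written as a sum
  so that the degrees of the terms can be compared.\<close>

definition pullback :: "complex poly \<Rightarrow> complex poly \<Rightarrow> complex poly poly \<Rightarrow> complex poly" where
  "pullback A B G = (\<Sum>j\<le>degree G. pcompose (coeff G j) A * B ^ j)"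

lemma eval2_altdef: "eval2 G x y = (\<Sum>j\<le>degree G. poly (coeff G j) x * y ^ j)"
  by (simp add: eval2_def poly_altdef[of G] poly_sum poly_power)

lemma poly_pullback: "poly (pullback A B G) t = eval2 G (poly A t) (poly B t)"
  by (simp add: pullback_def eval2_altdef poly_sum poly_pcompose)

lemma eval2_diff [simp]: "eval2 (F - G) x y = eval2 F x y - eval2 G x y"
  and eval2_smult [simp]: "eval2 (smult p F) x y = poly p x * eval2 F x y"
  and eval2_mult [simp]: "eval2 (F * G) x y = eval2 F x y * eval2 G x y"
  by (simp_all add: eval2_def)

lemma vanishing_ideal_zariski_closure: "vanishing_ideal (zariski_closure S) = vanishing_ideal S"
  by (fastforce simp: vanishing_ideal_def zariski_closure_def)

lemma zariski_closure_principal: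
  assumes "vanishing_ideal S = {G. F dvd G}"
  shows "zariski_closure S = {(x, y). eval2 F x y = 0}"
  unfolding zariski_closure_def assms by (auto elim!: dvdE)

text \<open>Two generators of the same principal ideal differ by a unit, and the units of \<open>\<complex>[x, y]\<close> are the
  nonzero constants. This transfers facts about an explicit generator to the chosen one.\<close>

lemma defining_poly_unique:
  assumes "vanishing_ideal X = {G. F dvd G}"
  obtains c where "c \<noteq> 0" "defining_poly X = [:[:c:]:] * F"
proof -
  have "vanishing_ideal X = {G. defining_poly X dvd G}"
    unfolding defining_poly_def by (rule someI[of _ F]) (rule assms)
  with assms have "{G. F dvd G} = {G. defining_poly X dvd G}"
    by simp
  then have "F dvd defining_poly X" "defining_poly X dvd F"
    by (metis dvd_refl mem_Collect_eq)+
  then obtain k l where k: "defining_poly X = F * k" and l: "F = defining_poly X * l"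
    unfolding dvd_def by blast
  obtain u where u: "u dvd 1" "defining_poly X = u * F"
  proof (cases "F = 0")
    case True
    with k that[of 1] show thesis by simp
  next
    case False
    have "F * (k * l) = F * 1"
      unfolding k[symmetric] mult.assoc[symmetric] by (simp add: l[symmetric])
    with False have "k * l = 1"
      by (simp only: mult_cancel_left) simp
    with k that[of k] show thesis
      by (metis dvd_triv_left mult.commute)
  qed
  then obtain c where "u = [:[:c:]:]" "c dvd 1"
    by (auto simp: is_unit_poly_iff)
  with u(2) show thesis by (intro that[of c]) auto
qed

lemma total_degree_smult:
  assumes "c \<noteq> 0"
  shows "total_degree ([:[:c:]:] * F) = total_degree F"
  using assms by (simp add: total_degree_def)

lemma finite_exponents: "finite {i + j |i j. coeff (coeff F j) i \<noteq> 0}"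
proof (rule finite_subset)
  show "{i + j |i j. coeff (coeff F j) i \<noteq> 0}
      \<subseteq> (\<lambda>(j, i). i + j) ` (SIGMA j:{..degree F}. {..degree (coeff F j)})"
  proof clarify
    fix i j assume nz: "coeff (coeff F j) i \<noteq> 0"
    then have "i \<le> degree (coeff F j)" "j \<le> degree F"
      by (auto intro: le_degree)
    then show "i + j \<in> (\<lambda>(j, i). i + j) ` (SIGMA j:{..degree F}. {..degree (coeff F j)})"
      by (auto intro!: image_eqI[of _ _ "(j, i)"])
  qed
qed auto

lemma total_degree_ge: "coeff (coeff F j) i \<noteq> 0 \<Longrightarrow> i + j \<le> total_degree F"
  unfolding total_degree_def by (intro Max_ge) (auto simp: finite_exponents)

lemma total_degree_eqI:
  assumes "\<And>i j. coeff (coeff F j) i \<noteq> 0 \<Longrightarrow> i + j \<le> n" "coeff (coeff F j) i \<noteq> 0" "i + j = n"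
  shows "total_degree F = n"
  unfolding total_degree_def by (intro Max_eqI) (use assms finite_exponents in auto)


section \<open>The implicit equation of a Chebyshev curve\<close>

definition chebyshev_eq :: "nat \<Rightarrow> nat \<Rightarrow> complex poly poly" where
  "chebyshev_eq a b = [:chebyshev_T b:] - map_poly (\<lambda>c. [:c:]) (chebyshev_T a)"

lemma coeff_chebyshev_eq:
  "coeff (coeff (chebyshev_eq a b) j) i =
     (if j = 0 then coeff (chebyshev_T b) i else 0) - (if i = 0 then coeff (chebyshev_T a) j else 0)"
  by (auto simp: chebyshev_eq_def coeff_map_poly coeff_pCons split: nat.splits)

lemma eval2_chebyshev_eq:
  "eval2 (chebyshev_eq a b) x y = poly (chebyshev_T b) x - poly (chebyshev_T a) y"
proof -
  have "poly (map_poly (\<lambda>c. [:c:]) p) [:y:] = [:poly p y:]" for p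
    by (induction p) (auto simp: map_poly_pCons)
  then show ?thesis by (simp add: eval2_def chebyshev_eq_def)
qed

lemma degree_chebyshev_eq:
  assumes "a \<noteq> 0"
  shows "degree (chebyshev_eq a b) = a"
  and "coeff (chebyshev_eq a b) a = [:- coeff (chebyshev_T a) a:]"
proof -
  show lc: "coeff (chebyshev_eq a b) a = [:- coeff (chebyshev_T a) a:]"
    using assms by (auto simp: poly_eq_iff coeff_chebyshev_eq coeff_pCons split: nat.splits)
  have nz: "coeff (chebyshev_T a) a \<noteq> 0"
    using leading_coeff_0_iff[of "chebyshev_T a"] chebyshev_T_nonzero[of a]
    by (simp add: degree_chebyshev_T)
  have "coeff (chebyshev_eq a b) j = 0" if "j > a" for j
    using that coeff_eq_0[of "chebyshev_T a" j]
    by (auto simp: poly_eq_iff coeff_chebyshev_eq degree_chebyshev_T)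
  then have "degree (chebyshev_eq a b) \<le> a"
    by (intro degree_le) auto
  moreover have "a \<le> degree (chebyshev_eq a b)"
    by (rule le_degree) (simp add: lc nz)
  ultimately show "degree (chebyshev_eq a b) = a" by simp
qed

text \<open>With \<open>x = cos (a * \<theta>)\<close> and \<open>y = cos \<psi>\<close>, the equation says that \<open>a * \<psi>\<close> and \<open>a * b * \<theta>\<close> agree
  up to sign and a multiple \<open>2 * m * pi\<close> of the period. A shift of \<open>\<theta>\<close> by \<open>2 * j * pi / a\<close> leaves
  \<open>x\<close> unchanged and moves \<open>b * \<theta>\<close> by \<open>2 * b * j * pi / a\<close>. Since \<open>b\<close> is invertible modulo \<open>a\<close>,
  some \<open>j\<close> makes this shift equal to \<open>2 * m * pi / a\<close> modulo the period.\<close>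

lemma chebyshev_eq_zero_imp_image:
  assumes "a \<noteq> 0" "coprime a b" "eval2 (chebyshev_eq a b) x y = 0"
  shows "\<exists>t. x = poly (chebyshev_T a) t \<and> y = poly (chebyshev_T b) t"
proof -
  define \<theta> where "\<theta> = Arccos x / of_nat a"
  define \<phi> where "\<phi> = Arccos y"
  have x: "x = cos (of_nat a * \<theta>)" and y: "y = cos \<phi>"
    using assms(1) by (auto simp: \<theta>_def \<phi>_def)
  have "cos (of_nat a * \<phi>) = cos (of_nat b * (of_nat a * \<theta>))"
    using assms(3) unfolding eval2_chebyshev_eq x y poly_chebyshev_T_cos by simp
  then obtain n where n: "n \<in> \<int>"
    "of_nat a * \<phi> = of_nat b * (of_nat a * \<theta>) + of_real (2 * n * pi) \<or>
     of_nat a * \<phi> = - (of_nat b * (of_nat a * \<theta>)) + of_real (2 * n * pi)"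
    unfolding complex_cos_eq by blast
  \<comment> \<open>Cosine is even, so \<open>\<phi>\<close> may be replaced by its negative.\<close>
  obtain \<psi> m where \<psi>: "y = cos \<psi>"
    "of_nat a * \<psi> = of_nat b * (of_nat a * \<theta>) + of_int m * (2 * of_real pi)"
    using n(2)
  proof
    assume "of_nat a * \<phi> = of_nat b * (of_nat a * \<theta>) + of_real (2 * n * pi)"
    with n(1) y show thesis
      by (auto elim!: Ints_cases intro!: that[of \<phi>])
  next
    assume *: "of_nat a * \<phi> = - (of_nat b * (of_nat a * \<theta>)) + of_real (2 * n * pi)"
    obtain m where "n = of_int m" using n(1) by (auto elim: Ints_cases)
    with y * show thesis
      by (intro that[of "- \<phi>" "- m"]) (auto simp: algebra_simps)
  qed
  obtain u v where "u * int a + v * int b = 1"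
    using bezout_int[of "int a" "int b"] assms(2) by (auto simp: coprime_iff_gcd_eq_1)
  then have uv: "of_int u * of_nat a + of_int v * of_nat b = (1 :: complex)"
    by (metis of_int_1 of_int_add of_int_mult of_int_of_nat_eq)
  \<comment> \<open>The witness is \<open>j = m * v\<close>, because \<open>v\<close> inverts \<open>b\<close> modulo \<open>a\<close>.\<close>
  define \<theta>' where "\<theta>' = \<theta> + of_int (m * v) * (2 * of_real pi) / of_nat a"
  have "of_nat a * \<theta>' = of_nat a * \<theta> + of_real (2 * of_int (m * v) * pi)"
    using assms(1) by (simp add: \<theta>'_def field_simps)
  then have 1: "x = cos (of_nat a * \<theta>')"
    unfolding x complex_cos_eq
    by (intro bexI[of _ "of_int (- (m * v))"] disjI1) (auto simp: algebra_simps)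
  have "of_nat a * \<psi> = of_nat a * (of_nat b * \<theta>' + of_real (2 * of_int (m * u) * pi))"
  proof -
    have "of_int m * (2 * of_real pi) = of_int m * (2 * of_real pi) * (of_int u * of_nat a + of_int v * of_nat b :: complex)"
      by (simp add: uv)
    then show ?thesis
      unfolding \<psi>(2) \<theta>'_def using assms(1) by (simp add: field_simps)
  qed
  then have "\<psi> = of_nat b * \<theta>' + of_real (2 * of_int (m * u) * pi)"
    using assms(1) by (metis mult_cancel_left of_nat_eq_0_iff)
  then have 2: "y = cos (of_nat b * \<theta>')"
    unfolding \<psi>(1) complex_cos_eq by (intro bexI[of _ "of_int (m * u)"] disjI1) auto
  show ?thesis
    using 1 2 by (intro exI[of _ "cos \<theta>'"]) (simp add: poly_chebyshev_T_cos)
qed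

text \<open>The nonzero summand of largest degree would contribute an uncancelled leading term.\<close>

lemma sum_distinct_degrees_eq_0:
  fixes p :: "'i \<Rightarrow> 'a::comm_ring_1 poly"
  assumes "finite J" "(\<Sum>j\<in>J. p j) = 0"
    and inj: "\<And>i j. i \<in> J \<Longrightarrow> j \<in> J \<Longrightarrow> p i \<noteq> 0 \<Longrightarrow> p j \<noteq> 0 \<Longrightarrow> degree (p i) = degree (p j) \<Longrightarrow> i = j"
    and "j \<in> J"
  shows "p j = 0"
proof (rule ccontr)
  assume "p j \<noteq> 0"
  define N where "N = {j \<in> J. p j \<noteq> 0}"
  have "finite N" "N \<noteq> {}"
    using assms \<open>p j \<noteq> 0\<close> by (auto simp: N_def)
  then obtain m where m: "m \<in> N" "\<And>k. k \<in> N \<Longrightarrow> degree (p k) \<le> degree (p m)"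
    using Max_in[of "(degree \<circ> p) ` N"] Max_ge[of "(degree \<circ> p) ` N"] by fastforce
  have "coeff (p k) (degree (p m)) = 0" if "k \<in> J - {m}" for k
  proof (cases "p k = 0")
    case False
    with that m inj[of k m] have "degree (p k) < degree (p m)"
      by (fastforce simp: N_def)
    then show ?thesis by (rule coeff_eq_0)
  qed auto
  moreover have "m \<in> J" using m by (simp add: N_def)
  ultimately have "coeff (\<Sum>j\<in>J. p j) (degree (p m)) = lead_coeff (p m)"
    using \<open>finite J\<close> by (simp add: coeff_sum sum.remove[of J m])
  with assms(2) m(1) show False by (simp add: N_def)
qed

text \<open>The term \<open>r j (x) * y ^ j\<close> is pulled back to a polynomial of degree
  \<open>degree (r j) * degree A + j * degree B\<close>. Modulo \<open>degree A\<close> this determines \<open>j\<close>, because \<open>degree B\<close> is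
  invertible and \<open>j < degree A\<close>.\<close>

lemma pullback_eq_0_imp_eq_0:
  assumes "coprime (degree A) (degree B)" "degree A \<noteq> 0" "degree R < degree A"
    and "B \<noteq> 0" "pullback A B R = 0"
  shows "R = 0"
proof (rule poly_eqI)
  fix j
  let ?p = "\<lambda>j. pcompose (coeff R j) A * B ^ j"
  have deg: "degree (?p j) = degree (coeff R j) * degree A + j * degree B" if "?p j \<noteq> 0" for j
    using that assms(4) by (simp add: degree_mult_eq degree_pcompose degree_power_eq)
  show "coeff R j = coeff 0 j"
  proof (cases "j \<le> degree R")
    case True
    have "?p j = 0"
    proof (rule sum_distinct_degrees_eq_0[where p = ?p and J = "{..degree R}"])
      fix i k assume *: "i \<in> {..degree R}" "k \<in> {..degree R}" "?p i \<noteq> 0" "?p k \<noteq> 0"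
        "degree (?p i) = degree (?p k)"
      \<comment> \<open>Modulo \<open>degree A\<close> the degrees are \<open>i * degree B\<close> and \<open>k * degree B\<close>.\<close>
      then have "[i * degree B = k * degree B] (mod degree A)"
        unfolding deg[OF *(3)] deg[OF *(4)]
        by (metis cong_def mod_mult_self3)
      then have "[i = k] (mod degree A)"
        using assms(1) by (simp add: cong_mult_rcancel_nat coprime_commute)
      then show "i = k"
        using * assms(3) by (auto intro: cong_less_modulus_unique_nat)
    qed (use True assms(5) in \<open>auto simp: pullback_def\<close>)
    then show ?thesis
      using assms(2,4) by (auto simp: pcompose_eq_0_iff)
  qed (simp add: coeff_eq_0)
qed

text \<open>As a polynomial in \<open>y\<close>, the implicit equation has a constant leading coefficient, so division by it
  is possible over \<open>\<complex>[x]\<close>. The remainder vanishes on the curve and has degree less than \<open>a\<close> in \<open>y\<close>,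
  hence it is zero.\<close>

lemma vanishing_ideal_chebyshev_curve:
  assumes "a \<noteq> 0" "coprime a b"
  shows "vanishing_ideal (chebyshev_curve a b) = {G. chebyshev_eq a b dvd G}"
proof -
  let ?F = "chebyshev_eq a b" and ?A = "chebyshev_T a" and ?B = "chebyshev_T b"
  have F0: "eval2 ?F (poly ?A t) (poly ?B t) = 0" for t
  proof -
    obtain z where "t = cos z" by (metis cos_Arccos)
    then show ?thesis
      by (simp add: eval2_chebyshev_eq poly_chebyshev_T_cos algebra_simps)
  qed
  have nz: "?F \<noteq> 0"
    using degree_chebyshev_eq(1)[OF assms(1), of b] assms(1) by auto
  have "?F dvd G" if G: "\<And>t. eval2 G (poly ?A t) (poly ?B t) = 0" for G
  proof -
    define R where "R = pseudo_mod G ?F"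
    obtain q where q: "smult (lead_coeff ?F ^ (Suc (degree G) - degree ?F)) G = ?F * q + R"
      and R: "R = 0 \<or> degree R < degree ?F"
      using pseudo_divmod[OF nz, of G "fst (pseudo_divmod G ?F)" "snd (pseudo_divmod G ?F)"]
      by (auto simp: R_def pseudo_mod_def)
    define l where "l = lead_coeff ?F ^ (Suc (degree G) - degree ?F)"
    have "lead_coeff ?F dvd 1"
      using leading_coeff_0_iff[of "chebyshev_T a"] degree_chebyshev_eq[OF assms(1), of b]
      by (auto simp: is_unit_const_poly_iff dvd_field_iff degree_chebyshev_T chebyshev_T_nonzero)
    then have unit: "l dvd 1"
      unfolding l_def by (metis dvd_power_same power_one)
    have R_eq: "R = [:l:] * G - ?F * q"
      using q by (simp add: l_def)
    have "poly (pullback ?A ?B R) t = 0" for t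
      unfolding poly_pullback by (simp add: R_eq G F0)
    then have "pullback ?A ?B R = 0"
      using poly_all_0_iff_0 by blast
    then have "R = 0"
      using R assms pullback_eq_0_imp_eq_0[of ?A ?B R]
      by (auto simp: degree_chebyshev_T chebyshev_T_nonzero degree_chebyshev_eq)
    with R_eq have "?F dvd [:l:] * G" by simp
    moreover from unit have "[:[:inverse (coeff l 0):]:] * ([:l:] * G) = G"
      by (auto simp: is_unit_poly_iff field_simps dvd_field_iff simp flip: one_pCons)
    ultimately show ?thesis
      by (metis dvd_mult)
  qed
  then show ?thesis
    using F0 unfolding chebyshev_curve_def vanishing_ideal_zariski_closure
    by (auto simp: vanishing_ideal_def elim!: dvdE)
qed

lemma total_degree_chebyshev_eq:
  assumes "a < b"
  shows "total_degree (chebyshev_eq a b) = b"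
proof (rule total_degree_eqI[where i = b and j = 0])
  show "i + j \<le> b" if "coeff (coeff (chebyshev_eq a b) j) i \<noteq> 0" for i j
    using that assms le_degree[of "chebyshev_T a" j] le_degree[of "chebyshev_T b" i]
    by (auto simp: coeff_chebyshev_eq degree_chebyshev_T split: if_splits)
  show "coeff (coeff (chebyshev_eq a b) 0) b \<noteq> 0"
    using assms leading_coeff_0_iff[of "chebyshev_T b"] chebyshev_T_nonzero[of b]
    by (auto simp: coeff_chebyshev_eq degree_chebyshev_T)
qed auto


section \<open>Binary forms\<close>

text \<open>The homogenization in degree \<open>n\<close> of the univariate polynomial \<open>f\<close>, evaluated at two polynomials. Linear
  \<open>P\<close> and \<open>Q\<close> give the restriction to a parametrized line, as needed for multiplicities; constant
  ones give the value at a point.\<close>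

definition binary_form :: "nat \<Rightarrow> complex poly \<Rightarrow> complex poly \<Rightarrow> complex poly \<Rightarrow> complex poly" where
  "binary_form n f P Q = (\<Sum>k\<le>n. smult (coeff f k) (P ^ k * Q ^ (n - k)))"

lemma binary_form_sum: "binary_form n (\<Sum>j\<in>J. f j) P Q = (\<Sum>j\<in>J. binary_form n (f j) P Q)"
  unfolding binary_form_def coeff_sum smult_sum by (rule sum.swap)

lemma binary_form_monom:
  assumes "c \<noteq> 0 \<Longrightarrow> k \<le> n"
  shows "binary_form n (monom c k) P Q = smult c (P ^ k * Q ^ (n - k))"
proof (cases "c = 0")
  case False
  then have "k \<le> n" using assms by simp
  have "binary_form n (monom c k) P Q = (\<Sum>i\<le>n. if i = k then smult c (P ^ k * Q ^ (n - k)) else 0)"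
    unfolding binary_form_def by (intro sum.cong) auto
  with \<open>k \<le> n\<close> show ?thesis by simp
qed (simp add: binary_form_def)

lemma poly_binary_form_affine:
  assumes "degree f \<le> n" "poly Q s \<noteq> 0"
  shows "poly (binary_form n f P Q) s = poly Q s ^ n * poly f (poly P s / poly Q s)"
proof -
  have "poly f z = (\<Sum>k\<le>n. coeff f k * z ^ k)" for z
    unfolding poly_altdef
    by (rule sum.mono_neutral_left) (use assms in \<open>auto simp: coeff_eq_0\<close>)
  then show ?thesis
    using assms(2) unfolding binary_form_def
    by (auto simp: poly_sum sum_distrib_left power_divide power_diff intro!: sum.cong)
qed

lemma poly_binary_form_infinity:
  assumes "poly Q s = 0"
  shows "poly (binary_form n f P Q) s = coeff f n * poly P s ^ n"
proof -
  have "poly (binary_form n f P Q) s = (\<Sum>k\<le>n. if k = n then coeff f n * poly P s ^ n else 0)"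
    unfolding binary_form_def poly_sum using assms by (intro sum.cong) auto
  then show ?thesis by simp
qed

lemma binary_form_linear_factor:
  assumes "degree g \<le> n"
  shows "binary_form (Suc n) ([:- r, 1:] * g) P Q = (P - smult r Q) * binary_form n g P Q"
proof -
  have "binary_form (Suc n) ([:- r, 1:] * g) P Q
      = (\<Sum>k\<le>Suc n. smult (coeff (pCons 0 g) k) (P ^ k * Q ^ (Suc n - k)))
        - (\<Sum>k\<le>Suc n. smult (r * coeff g k) (P ^ k * Q ^ (Suc n - k)))"
    unfolding binary_form_def sum_subtractf[symmetric]
    by (intro sum.cong) (auto simp: smult_diff_left algebra_simps)
  also have "(\<Sum>k\<le>Suc n. smult (coeff (pCons 0 g) k) (P ^ k * Q ^ (Suc n - k))) = P * binary_form n g P Q"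
    unfolding binary_form_def sum_distrib_left
    by (subst sum.atMost_Suc_shift) (auto simp: mult_ac intro!: sum.cong)
  also have "(\<Sum>k\<le>Suc n. smult (r * coeff g k) (P ^ k * Q ^ (Suc n - k))) = smult r Q * binary_form n g P Q"
    unfolding binary_form_def sum_distrib_left using assms
    by (auto simp: coeff_eq_0 Suc_diff_le mult_ac intro!: sum.cong)
  finally show ?thesis by (simp add: algebra_simps)
qed

lemma binary_form_linear_power:
  assumes "degree g \<le> n"
  shows "binary_form (k + n) ([:- r, 1:] ^ k * g) P Q = (P - smult r Q) ^ k * binary_form n g P Q"
proof (induction k)
  case (Suc k)
  have "degree ([:- r, 1:] ^ k * g) \<le> k + n"
    using assms degree_mult_le[of "[:- r, 1:] ^ k" g] by (simp add: degree_linear_power)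
  then show ?case
    using Suc binary_form_linear_factor[of "[:- r, 1:] ^ k * g" "k + n" r P Q]
    by (simp add: mult_ac)
qed simp

lemma binary_form_raise_degree:
  assumes "degree f \<le> n"
  shows "binary_form n f P Q = Q ^ (n - degree f) * binary_form (degree f) f P Q"
proof -
  have "binary_form n f P Q = (\<Sum>k\<le>degree f. smult (coeff f k) (P ^ k * Q ^ (n - k)))"
    unfolding binary_form_def
    by (rule sum.mono_neutral_right) (use assms in \<open>auto simp: coeff_eq_0\<close>)
  also have "\<dots> = Q ^ (n - degree f) * binary_form (degree f) f P Q"
    unfolding binary_form_def sum_distrib_left
    using assms by (auto simp: mult.left_commute power_add[symmetric] intro!: sum.cong)
  finally show ?thesis .
qed

text \<open>Both kinds of points on a line lead to such a product: a power of a linear form that vanishes at the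
  point, times a factor that does not.\<close>

lemma order_0_linear_power_mult:
  fixes u :: "complex poly"
  assumes "l \<noteq> 0" "poly u 0 \<noteq> 0"
  shows "order 0 ([:0, l:] ^ k * u) = k"
proof -
  have "[:0, l:] ^ k = smult (l ^ k) ([:- 0, 1:] ^ k)"
    using smult_power[of l "[:0, 1:]" k] by simp
  moreover have "u \<noteq> 0" using assms(2) by auto
  ultimately show ?thesis
    using assms by (simp add: order_mult order_smult order_0I order_power_n_n del: minus_zero)
qed

text \<open>The multiplicity of the zero \<open>[p0 : q0]\<close> of a binary form, measured along a parametrization
  through that point. The inequality says that the parametrization is not constant in the projective
  line. At infinity the multiplicity is the defect \<open>n - degree f\<close>, as the form is divisible by exactly
  that power of \<open>Q\<close>; elsewhere, split off the factor \<open>(P - r Q) ^ k\<close> from the root \<open>r\<close> of order \<open>k\<close>.\<close>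

lemma order_binary_form:
  assumes "f \<noteq> 0" "degree f \<le> n" "p0 * q1 \<noteq> p1 * q0"
  shows "order 0 (binary_form n f [:p0, p1:] [:q0, q1:]) =
    (if q0 = 0 then n - degree f else order (p0 / q0) f)"
proof (cases "q0 = 0")
  case True
  have "poly (binary_form (degree f) f [:p0, p1:] [:q0, q1:]) 0 = lead_coeff f * p0 ^ degree f"
    using True by (subst poly_binary_form_infinity) auto
  then have "order 0 ([:0, q1:] ^ (n - degree f) * binary_form (degree f) f [:p0, p1:] [:q0, q1:])
      = n - degree f"
    by (intro order_0_linear_power_mult) (use True assms in auto)
  then show ?thesis
    using True by (subst binary_form_raise_degree[OF assms(2)]) simp
next
  case False
  define r k where "r = p0 / q0" and "k = order r f"
  obtain g where g: "f = [:- r, 1:] ^ k * g" "\<not> [:- r, 1:] dvd g"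
    using order_decomp[OF assms(1), of r] by (auto simp: k_def)
  have "g \<noteq> 0" using assms(1) g by auto
  then have deg: "degree f = k + degree g"
    by (subst g(1)) (simp add: degree_mult_eq degree_linear_power)
  define m where "m = n - k"
  have m: "n = k + m" "degree g \<le> m"
    using deg assms(2) by (auto simp: m_def)
  have "poly (binary_form m g [:p0, p1:] [:q0, q1:]) 0 = q0 ^ m * poly g r"
    using False m by (subst poly_binary_form_affine) (auto simp: r_def)
  also have "\<dots> \<noteq> 0"
    using g(2) False by (simp add: poly_eq_0_iff_dvd)
  finally have "order 0 ([:0, p1 - r * q1:] ^ k * binary_form m g [:p0, p1:] [:q0, q1:]) = k"
    using False assms(3) by (intro order_0_linear_power_mult) (auto simp: r_def field_simps)
  moreover have "[:p0, p1:] - smult r [:q0, q1:] = [:0, p1 - r * q1:]"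
    using False by (simp add: r_def)
  ultimately show ?thesis
    using False binary_form_linear_power[OF m(2), of k r "[:p0, p1:]" "[:q0, q1:]"]
    by (simp add: g(1)[symmetric] m(1)[symmetric] r_def[symmetric] k_def[symmetric])
qed

lemma sum_order_complex_poly:
  fixes f :: "complex poly"
  assumes "f \<noteq> 0"
  shows "(\<Sum>r | poly f r = 0. order r f) = degree f"
  using assms size_proots_complex[of f] by (simp add: size_multiset_overloaded_eq)


section \<open>Lines through the origin\<close>

text \<open>The point \<open>(\<beta> r, \<alpha> r)\<close> runs through the line \<open>\<alpha> x - \<beta> y = 0\<close>.\<close>

definition line_restriction :: "real \<Rightarrow> real \<Rightarrow> complex poly poly \<Rightarrow> complex poly" where
  "line_restriction \<alpha> \<beta> F = pullback [:0, of_real \<beta>:] [:0, of_real \<alpha>:] F"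

lemma poly_line_restriction:
  "poly (line_restriction \<alpha> \<beta> F) r = eval2 F (of_real \<beta> * r) (of_real \<alpha> * r)"
  by (simp add: line_restriction_def poly_pullback mult.commute)

lemma line_restriction_altdef:
  "line_restriction \<alpha> \<beta> F = (\<Sum>j\<le>degree F. \<Sum>i\<le>degree (coeff F j).
     monom (coeff (coeff F j) i * of_real \<beta> ^ i * of_real \<alpha> ^ j) (i + j))"
proof -
  have 1: "pcompose p [:0, c:] = (\<Sum>i\<le>degree p. monom (coeff p i * c ^ i) i)" for p and c :: complex
    by (auto simp: poly_eq_iff coeff_sum coeff_pcompose_linear coeff_eq_0 if_distrib cong: if_cong)
  have 2: "[:0, c:] ^ j = monom (c ^ j) j" for c :: complex and j
    using smult_power[of c "[:0, 1:]" j] by (simp add: monom_altdef)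
  show ?thesis
    unfolding line_restriction_def pullback_def 1 2 sum_distrib_right mult_monom ..
qed

lemma degree_line_restriction_le: "degree (line_restriction \<alpha> \<beta> F) \<le> total_degree F"
  unfolding line_restriction_altdef
proof (intro degree_sum_le; simp?)
  fix j i
  show "degree (monom (coeff (coeff F j) i * of_real \<beta> ^ i * of_real \<alpha> ^ j :: complex) (i + j)) \<le> total_degree F"
    using degree_monom_le[of "coeff (coeff F j) i * of_real \<beta> ^ i * of_real \<alpha> ^ j" "i + j"]
      total_degree_ge[of F j i]
    by (cases "coeff (coeff F j) i = 0") auto
qed

text \<open>Homogenizing commutes with the restriction to a line through the origin. The degree used on the right
  is the total degree of \<open>F\<close>, which may exceed the degree of the restricted polynomial; the
  difference is what the line meets at infinity.\<close>

lemma homogenization_line: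
  "homogenization (\<lambda>c. [:c:]) F (smult (of_real \<beta>) P) (smult (of_real \<alpha>) P) Q =
     binary_form (total_degree F) (line_restriction \<alpha> \<beta> F) P Q"
proof -
  have "binary_form (total_degree F)
      (monom (coeff (coeff F j) i * of_real \<beta> ^ i * of_real \<alpha> ^ j) (i + j)) P Q
    = [:coeff (coeff F j) i:] * smult (of_real \<beta>) P ^ i * smult (of_real \<alpha>) P ^ j *
        Q ^ (total_degree F - i - j)" for i j
    using total_degree_ge[of F j i]
    by (subst binary_form_monom) (auto simp: smult_power power_add mult_ac)
  then show ?thesis
    unfolding homogenization_def line_restriction_altdef binary_form_sum by simp
qed

lemma poly_homogenization:
  "poly (homogenization (\<lambda>c. [:c:]) F x y z) s = homogenization id F (poly x s) (poly y s) (poly z s)"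
  by (simp add: homogenization_def poly_sum mult.assoc)

text \<open>Homogeneous coordinates \<open>(p, q)\<close> on the projective line \<open>\<alpha> x - \<beta> y = 0\<close>: the point at infinity
  is \<open>q = 0\<close>, the origin is \<open>p = 0\<close>.\<close>

definition line_vec :: "real \<Rightarrow> real \<Rightarrow> complex \<Rightarrow> complex \<Rightarrow> complex ^ 3" where
  "line_vec \<alpha> \<beta> p q = vector [of_real \<beta> * p, of_real \<alpha> * p, q]"

lemma line_vec_nth [simp]:
  "line_vec \<alpha> \<beta> p q $ 1 = of_real \<beta> * p" "line_vec \<alpha> \<beta> p q $ 2 = of_real \<alpha> * p"
  "line_vec \<alpha> \<beta> p q $ 3 = q"
  by (simp_all add: line_vec_def)

lemma scale_line_vec: "c *s line_vec \<alpha> \<beta> p q = line_vec \<alpha> \<beta> (c * p) (c * q)"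
  by (simp add: vec_eq_iff forall_3)

lemma homogenization_line_vec:
  fixes F p q \<alpha> \<beta>
  defines "v \<equiv> line_vec \<alpha> \<beta> p q" and "f \<equiv> line_restriction \<alpha> \<beta> F" and "n \<equiv> total_degree F"
  shows "homogenization id F (v $ 1) (v $ 2) (v $ 3) =
    (if q = 0 then coeff f n * p ^ n else q ^ n * poly f (p / q))"
proof -
  have "homogenization id F (v $ 1) (v $ 2) (v $ 3) = poly (binary_form n f [:p:] [:q:]) 0"
    using poly_homogenization[of F "smult (of_real \<beta>) [:p:]" "smult (of_real \<alpha>) [:p:]" "[:q:]" 0]
    unfolding homogenization_line by (simp add: v_def f_def n_def)
  then show ?thesis
    using degree_line_restriction_le[of \<alpha> \<beta> F]
    by (simp add: poly_binary_form_infinity poly_binary_form_affine f_def n_def)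
qed

lemma proj_point_self: "v \<in> proj_point v"
  unfolding proj_point_def using vector_smult_lid[of v] by (intro CollectI exI[of _ 1]) simp

lemma proj_point_scale:
  assumes "c \<noteq> 0"
  shows "proj_point (c *s v) = proj_point v"
  unfolding proj_point_def
proof (intro set_eqI iffI)
  fix w assume "w \<in> {d *s (c *s v) |d. d \<noteq> 0}"
  then obtain d where "w = (d * c) *s v" "d \<noteq> 0"
    by (auto simp: vector_smult_assoc)
  with assms show "w \<in> {d *s v |d. d \<noteq> 0}" by auto
next
  fix w assume "w \<in> {d *s v |d. d \<noteq> 0}"
  then obtain d where "w = (d / c) *s (c *s v)" "d / c \<noteq> 0"
    using assms by (auto simp: vector_smult_assoc)
  then show "w \<in> {d *s (c *s v) |d. d \<noteq> 0}" by blast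
qed

context
  fixes \<alpha> \<beta> :: real
  assumes line: "(\<alpha>, \<beta>) \<noteq> (0, 0)"
begin

lemma line_vec_eq_0_iff: "line_vec \<alpha> \<beta> p q = 0 \<longleftrightarrow> p = 0 \<and> q = 0"
  using line by (auto simp: vec_eq_iff forall_3)

lemma line_vec_eq_iff: "line_vec \<alpha> \<beta> p q = line_vec \<alpha> \<beta> p' q' \<longleftrightarrow> p = p' \<and> q = q'"
  using line by (auto simp: vec_eq_iff forall_3)

lemma on_line_imp_line_vec:
  assumes "of_real \<alpha> * v $ 1 - of_real \<beta> * v $ 2 = 0"
  shows "\<exists>p q. v = line_vec \<alpha> \<beta> p q"
proof (cases "\<beta> = 0")
  case True
  with line assms show ?thesis
    by (intro exI[of _ "v $ 2 / of_real \<alpha>"] exI[of _ "v $ 3"]) (simp add: vec_eq_iff forall_3)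
next
  case False
  with assms show ?thesis
    by (intro exI[of _ "v $ 1 / of_real \<beta>"] exI[of _ "v $ 3"]) (simp add: vec_eq_iff forall_3 field_simps)
qed

lemma proj_line_eq:
  "proj_line_through_origin \<alpha> \<beta> = {proj_point (line_vec \<alpha> \<beta> p q) |p q. (p, q) \<noteq> (0, 0)}"
proof (intro set_eqI iffI)
  fix P assume "P \<in> proj_line_through_origin \<alpha> \<beta>"
  then obtain v where v: "P = proj_point v" "v \<noteq> 0"
    "of_real \<alpha> * v $ 1 - of_real \<beta> * v $ 2 = 0"
    using proj_point_self by (auto simp: proj_line_through_origin_def proj_plane_def)
  from on_line_imp_line_vec[OF v(3)] obtain p q where "v = line_vec \<alpha> \<beta> p q" by blast
  with v(1,2) have "P = proj_point (line_vec \<alpha> \<beta> p q)" "(p, q) \<noteq> (0, 0)"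
    by (auto simp: line_vec_eq_0_iff)
  then show "P \<in> {proj_point (line_vec \<alpha> \<beta> p q) |p q. (p, q) \<noteq> (0, 0)}" by blast
next
  fix P assume "P \<in> {proj_point (line_vec \<alpha> \<beta> p q) |p q. (p, q) \<noteq> (0, 0)}"
  then obtain p q where P: "P = proj_point (line_vec \<alpha> \<beta> p q)" "(p, q) \<noteq> (0, 0)"
    by blast
  then have "P \<in> proj_plane"
    by (auto simp: proj_plane_def line_vec_eq_0_iff)
  with P(1) show "P \<in> proj_line_through_origin \<alpha> \<beta>"
    by (auto simp: proj_line_through_origin_def proj_point_def scale_line_vec)
qed

lemma line_points_eq:
  assumes "p0 * q1 = p1 * q0" "(p0, q0) \<noteq> (0, 0)" "(p1, q1) \<noteq> (0, 0)"
  shows "proj_point (line_vec \<alpha> \<beta> p0 q0) = proj_point (line_vec \<alpha> \<beta> p1 q1)"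
proof -
  obtain c where "p1 = c * p0" "q1 = c * q0"
  proof (cases "p0 = 0")
    case True
    with assms that[of "q1 / q0"] show thesis by auto
  next
    case False
    with assms that[of "p1 / p0"] show thesis by (auto simp: field_simps)
  qed
  with assms(3) proj_point_scale[of c "line_vec \<alpha> \<beta> p0 q0"] show ?thesis
    by (auto simp: scale_line_vec)
qed

lemma line_points_eq_iff:
  assumes "(p0, q0) \<noteq> (0, 0)" "(p1, q1) \<noteq> (0, 0)"
  shows "proj_point (line_vec \<alpha> \<beta> p0 q0) = proj_point (line_vec \<alpha> \<beta> p1 q1) \<longleftrightarrow> p0 * q1 = p1 * q0"
proof
  assume "proj_point (line_vec \<alpha> \<beta> p0 q0) = proj_point (line_vec \<alpha> \<beta> p1 q1)"
  then have "line_vec \<alpha> \<beta> p0 q0 \<in> proj_point (line_vec \<alpha> \<beta> p1 q1)"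
    using proj_point_self by metis
  then show "p0 * q1 = p1 * q0"
    by (auto simp: proj_point_def scale_line_vec line_vec_eq_iff)
qed (use line_points_eq assms in blast)

text \<open>Any admissible choice of \<open>v\<close> and \<open>w\<close> in the definition of the multiplicity has linearly independent
  line coordinates, and the order of the binary form depends only on the point that \<open>v\<close> represents.\<close>

lemma intersection_mult_line:
  fixes X F
  defines "F \<equiv> defining_poly X"
  defines "f \<equiv> line_restriction \<alpha> \<beta> F"
  assumes "f \<noteq> 0" "(p, q) \<noteq> (0, 0)"
  shows "intersection_mult X (proj_line_through_origin \<alpha> \<beta>) (proj_point (line_vec \<alpha> \<beta> p q)) =
    (if q = 0 then total_degree F - degree f else order (p / q) f)"
proof -
  define P where "P = proj_point (line_vec \<alpha> \<beta> p q)"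
  let ?L = "proj_line_through_origin \<alpha> \<beta>"
  let ?\<Phi> = "\<lambda>(v, w). v \<in> P \<and> w \<in> \<Union> (?L - {P})"
  have "\<exists>vw. ?\<Phi> vw"
  proof -
    \<comment> \<open>A second point of the line: the origin if \<open>P\<close> is at infinity, else the point at infinity.\<close>
    define p' q' where "p' = (if q = 0 then 0 else 1 :: complex)" and "q' = (if q = 0 then 1 else 0 :: complex)"
    have "proj_point (line_vec \<alpha> \<beta> p' q') \<noteq> P" "(p', q') \<noteq> (0, 0)"
      using assms(4) unfolding P_def by (subst line_points_eq_iff) (auto simp: p'_def q'_def)
    then have "?\<Phi> (line_vec \<alpha> \<beta> p q, line_vec \<alpha> \<beta> p' q')"
      unfolding proj_line_eq using proj_point_self by (auto simp: P_def)
    then show ?thesis by blast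
  qed
  define v w where "v = fst (SOME vw. ?\<Phi> vw)" and "w = snd (SOME vw. ?\<Phi> vw)"
  have vw: "v \<in> P" "w \<in> \<Union> (?L - {P})"
    using someI_ex[OF \<open>\<exists>vw. ?\<Phi> vw\<close>] by (auto simp: v_def w_def case_prod_beta)
  from vw(1) obtain c where c: "c \<noteq> 0" "v = line_vec \<alpha> \<beta> (c * p) (c * q)"
    by (auto simp: P_def proj_point_def scale_line_vec)
  from vw(2) obtain p' q' where w: "proj_point (line_vec \<alpha> \<beta> p' q') \<noteq> P" "(p', q') \<noteq> (0, 0)"
    and w_in: "w \<in> proj_point (line_vec \<alpha> \<beta> p' q')"
    unfolding proj_line_eq by blast
  from w_in obtain d where d: "d \<noteq> 0" "w = line_vec \<alpha> \<beta> (d * p') (d * q')"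
    by (auto simp: proj_point_def scale_line_vec)
  have "p * q' \<noteq> p' * q"
    using w(1) line_points_eq_iff[OF assms(4) w(2)] by (auto simp: P_def)
  then have indep: "(c * p) * (d * q') \<noteq> (d * p') * (c * q)"
    using c(1) d(1) by (auto simp: mult_ac)
  have "intersection_mult X ?L P
    = order 0 (homogenization (\<lambda>c. [:c:]) F [:v $ 1, w $ 1:] [:v $ 2, w $ 2:] [:v $ 3, w $ 3:])"
    unfolding intersection_mult_def v_def w_def F_def by (simp add: case_prod_beta)
  also have "\<dots> = order 0 (binary_form (total_degree F) f [:c * p, d * p':] [:c * q, d * q':])"
    using homogenization_line[of F \<beta> "[:c * p, d * p':]" \<alpha> "[:c * q, d * q':]"]
    by (simp add: c d f_def)
  also have "\<dots> = (if q = 0 then total_degree F - degree f else order (p / q) f)"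
    using order_binary_form[OF assms(3) _ indep, of "total_degree F"] c(1)
      degree_line_restriction_le[of \<alpha> \<beta> F] by (simp add: f_def)
  finally show ?thesis unfolding P_def .
qed

lemma line_meets_proj_closure:
  fixes X F
  defines "F \<equiv> defining_poly X"
  defines "f \<equiv> line_restriction \<alpha> \<beta> F"
  shows "proj_line_through_origin \<alpha> \<beta> \<inter> proj_closure X =
    (\<lambda>r. proj_point (line_vec \<alpha> \<beta> r 1)) ` {r. poly f r = 0} \<union>
    {P. P = proj_point (line_vec \<alpha> \<beta> 1 0) \<and> coeff f (total_degree F) = 0}"
proof -
  have in_closure: "proj_point (line_vec \<alpha> \<beta> p q) \<in> proj_closure X \<longleftrightarrow>
    (if q = 0 then coeff f (total_degree F) = 0 else poly f (p / q) = 0)" (is "?P \<in> _ \<longleftrightarrow> ?rhs")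
    if "(p, q) \<noteq> (0, 0)" for p q
  proof -
    have "?P \<in> proj_plane"
      using that line_vec_eq_0_iff by (auto simp: proj_plane_def)
    then have "?P \<in> proj_closure X \<longleftrightarrow>
      (\<forall>c. c \<noteq> 0 \<longrightarrow> homogenization id F (line_vec \<alpha> \<beta> (c * p) (c * q) $ 1)
        (line_vec \<alpha> \<beta> (c * p) (c * q) $ 2) (line_vec \<alpha> \<beta> (c * p) (c * q) $ 3) = 0)"
      by (auto simp: proj_closure_def F_def proj_point_def scale_line_vec)
    also have "\<dots> \<longleftrightarrow> (\<forall>c::complex. c \<noteq> 0 \<longrightarrow> ?rhs)"
      unfolding homogenization_line_vec using that by (auto simp: f_def)
    also have "\<dots> \<longleftrightarrow> ?rhs"
      using zero_neq_one by blast
    finally show ?thesis .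
  qed
  show ?thesis
  proof (intro set_eqI iffI)
    fix P assume "P \<in> proj_line_through_origin \<alpha> \<beta> \<inter> proj_closure X"
    then obtain p q where P: "P = proj_point (line_vec \<alpha> \<beta> p q)" "(p, q) \<noteq> (0, 0)" "P \<in> proj_closure X"
      unfolding proj_line_eq by auto
    show "P \<in> (\<lambda>r. proj_point (line_vec \<alpha> \<beta> r 1)) ` {r. poly f r = 0} \<union>
      {P. P = proj_point (line_vec \<alpha> \<beta> 1 0) \<and> coeff f (total_degree F) = 0}"
    proof (cases "q = 0")
      case True
      with P line_points_eq[of p 0 1 q] in_closure[OF P(2)] show ?thesis by auto
    next
      case False
      with P line_points_eq[of p 1 "p / q" q] in_closure[OF P(2)] show ?thesis by auto
    qed
  next
    fix P assume "P \<in> (\<lambda>r. proj_point (line_vec \<alpha> \<beta> r 1)) ` {r. poly f r = 0} \<union>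
      {P. P = proj_point (line_vec \<alpha> \<beta> 1 0) \<and> coeff f (total_degree F) = 0}"
    then show "P \<in> proj_line_through_origin \<alpha> \<beta> \<inter> proj_closure X"
      using in_closure unfolding proj_line_eq by fastforce
  qed
qed

lemma inj_line_points: "inj (\<lambda>r. proj_point (line_vec \<alpha> \<beta> r 1))"
  by (rule injI) (auto simp: line_points_eq_iff)

lemma sum_intersection_mult_affine:
  fixes X
  defines "f \<equiv> line_restriction \<alpha> \<beta> (defining_poly X)"
  assumes "f \<noteq> 0"
  shows "(\<Sum>r | poly f r = 0. intersection_mult X (proj_line_through_origin \<alpha> \<beta>)
    (proj_point (line_vec \<alpha> \<beta> r 1))) = degree f"
  using assms by (simp add: intersection_mult_line sum_order_complex_poly)

text \<open>As the roots are real, every intersection point is real and counted. The points at finite distance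
  contribute \<open>degree f\<close> by the fundamental theorem of algebra. If the degree of \<open>f\<close>
  is less than the total degree, then the point at infinity lies on the curve and contributes the
  difference; otherwise it does not lie on it. In both cases the sum is the total degree.\<close>

lemma hyperbolic_on_line:
  fixes X
  defines "f \<equiv> line_restriction \<alpha> \<beta> (defining_poly X)"
    and "R \<equiv> {P \<in> proj_line_through_origin \<alpha> \<beta> \<inter> proj_closure X. real_proj_point P}"
  assumes "f \<noteq> 0" and real: "\<And>r. poly f r = 0 \<Longrightarrow> r \<in> \<real>"
  shows "finite R" "(\<Sum>P\<in>R. intersection_mult X (proj_line_through_origin \<alpha> \<beta>) P) = curve_degree X"
proof -
  let ?n = "total_degree (defining_poly X)" and ?L = "proj_line_through_origin \<alpha> \<beta>"
  let ?pt = "\<lambda>r. proj_point (line_vec \<alpha> \<beta> r 1)"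
  define Z where "Z = {r. poly f r = 0}"
  define I where "I = {P. P = proj_point (line_vec \<alpha> \<beta> 1 0) \<and> coeff f ?n = 0}"
  have real_pt: "real_proj_point (proj_point (line_vec \<alpha> \<beta> p q))" if "p \<in> \<real>" "q \<in> \<real>" for p q
    unfolding real_proj_point_def using that
    by (intro bexI[OF _ proj_point_self]) (simp add: forall_3)
  have R: "R = ?pt ` Z \<union> I"
    unfolding R_def line_meets_proj_closure using real real_pt
    by (auto simp: Z_def I_def f_def)
  have fin: "finite Z" "finite I"
    using poly_roots_finite[OF assms(3)] by (auto simp: Z_def I_def)
  then show "finite R" by (simp add: R)
  have deg: "degree f \<le> ?n"
    unfolding f_def by (rule degree_line_restriction_le)
  have "coeff f ?n = 0 \<longleftrightarrow> degree f < ?n"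
    using assms(3) deg le_degree[of f ?n] by (metis coeff_eq_0 le_neq_implies_less leading_coeff_0_iff)
  then have I_sum: "(\<Sum>P\<in>I. intersection_mult X ?L P) = ?n - degree f"
    using assms(3) deg by (auto simp: I_def f_def intersection_mult_line)
  have "?pt ` Z \<inter> I = {}"
    by (auto simp: I_def line_points_eq_iff)
  then have "(\<Sum>P\<in>R. intersection_mult X ?L P)
      = (\<Sum>P\<in>?pt ` Z. intersection_mult X ?L P) + (\<Sum>P\<in>I. intersection_mult X ?L P)"
    unfolding R using fin by (intro sum.union_disjoint) auto
  also have "(\<Sum>P\<in>?pt ` Z. intersection_mult X ?L P) = degree f"
    using sum_intersection_mult_affine[of X] assms(3)
    by (subst sum.reindex) (auto simp: f_def Z_def intro: inj_on_subset[OF inj_line_points])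
  finally show "(\<Sum>P\<in>R. intersection_mult X ?L P) = curve_degree X"
    using I_sum deg by (simp add: curve_degree_def)
qed

end


section \<open>Hyperbolicity of the curves with parameters a and a + 1\<close>

theorem theorem3p5:
  fixes a :: nat
  assumes "a \<noteq> 0"
  defines "X \<equiv> chebyshev_curve a (a + 1)"
  shows "curve_degree X = a + 1 \<and>
    hyperbolic_wrt_origin X \<and>
    (\<forall>\<alpha> \<beta>. \<beta> \<noteq> 0 \<longrightarrow>
      (let R = {(x, y) \<in> line_through_origin \<alpha> \<beta> \<inter> X. x \<in> \<real> \<and> y \<in> \<real>}
       in finite R \<and>
          (\<Sum>p\<in>R. intersection_mult X (proj_line_through_origin \<alpha> \<beta>) (affine_point p)) = a + 1))"
proof -
  have coprime: "coprime a (a + 1)" by simp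
  define F D where "F = chebyshev_eq a (a + 1)" and "D = defining_poly X"
  have ideal: "vanishing_ideal X = {G. F dvd G}"
    unfolding X_def F_def using assms(1) coprime by (rule vanishing_ideal_chebyshev_curve)
  obtain c where c: "c \<noteq> 0" "D = [:[:c:]:] * F"
    using defining_poly_unique[OF ideal] by (auto simp: D_def)
  have deg: "total_degree D = a + 1"
    unfolding c(2) total_degree_smult[OF c(1)] F_def by (rule total_degree_chebyshev_eq) simp
  have X_eq: "X = {(x, y). eval2 D x y = 0}"
  proof -
    have "X = {(x, y). eval2 F x y = 0}"
      unfolding X_def chebyshev_curve_def
      by (rule zariski_closure_principal)
        (use ideal in \<open>simp add: X_def chebyshev_curve_def vanishing_ideal_zariski_closure\<close>)
    then show ?thesis using c by simp
  qed
  have real_root: "r \<in> \<real>"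
    if line: "(\<alpha>, \<beta>) \<noteq> (0, 0)" and root: "poly (line_restriction \<alpha> \<beta> D) r = 0" for \<alpha> \<beta> r
  proof -
    have "eval2 F (of_real \<beta> * r) (of_real \<alpha> * r) = 0"
      using root c by (simp add: poly_line_restriction)
    then obtain t where t: "of_real \<beta> * r = poly (chebyshev_T a) t"
      "of_real \<alpha> * r = poly (chebyshev_T (Suc a)) t"
      using chebyshev_eq_zero_imp_image[OF assms(1) coprime] by (auto simp: F_def)
    then have "of_real \<alpha> * poly (chebyshev_T a) t = of_real \<beta> * poly (chebyshev_T (Suc a)) t"
      by (simp flip: t add: mult_ac)
    then have "t \<in> \<real>"
      using real_chebyshev_pencil_root line by blast
    then have "of_real \<beta> * r \<in> \<real>" "of_real \<alpha> * r \<in> \<real>"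
      unfolding t by (simp_all only: real_poly_chebyshev_T)
    then show "r \<in> \<real>"
      using line by (auto simp: complex_is_Real_iff)
  qed
  \<comment> \<open>The zero polynomial would have nonreal roots.\<close>
  have nonzero: "line_restriction \<alpha> \<beta> D \<noteq> 0" if "(\<alpha>, \<beta>) \<noteq> (0, 0)" for \<alpha> \<beta>
    using real_root[OF that, of \<i>] by (auto simp: complex_is_Real_iff)
  have hyperbolic: "hyperbolic_wrt_origin X"
    unfolding hyperbolic_wrt_origin_def Let_def
  proof (intro allI impI conjI)
    fix \<alpha> \<beta> :: real assume line: "(\<alpha>, \<beta>) \<noteq> (0, 0)"
    note on_line = hyperbolic_on_line[OF line, of X, folded D_def, OF nonzero[OF line] real_root[OF line]]
    let ?R = "{P \<in> proj_line_through_origin \<alpha> \<beta> \<inter> proj_closure X. real_proj_point P}"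
    show "finite ?R" by (rule on_line(1))
    show "(\<Sum>P\<in>?R. intersection_mult X (proj_line_through_origin \<alpha> \<beta>) P) = curve_degree X"
      by (rule on_line(2))
  qed
  have affine: "finite R \<and>
      (\<Sum>p\<in>R. intersection_mult X (proj_line_through_origin \<alpha> \<beta>) (affine_point p)) = a + 1"
    if \<beta>: "\<beta> \<noteq> 0" and R_def: "R = {(x, y) \<in> line_through_origin \<alpha> \<beta> \<inter> X. x \<in> \<real> \<and> y \<in> \<real>}"
    for \<alpha> \<beta> R
  proof -
    have line: "(\<alpha>, \<beta>) \<noteq> (0, 0)" using \<beta> by simp
    define f where "f = line_restriction \<alpha> \<beta> D"
    define Z where "Z = {r. poly f r = 0}"
    let ?pt = "\<lambda>r::complex. (of_real \<beta> * r, of_real \<alpha> * r)"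
    have "R = ?pt ` Z"
    proof (intro set_eqI iffI)
      fix p assume "p \<in> R"
      then obtain x y where p: "p = (x, y)" "of_real \<alpha> * x = of_real \<beta> * y" "(x, y) \<in> X"
        by (auto simp: R_def line_through_origin_def)
      have "p = ?pt (x / of_real \<beta>)"
        using p(1,2) \<beta> by (simp add: field_simps)
      with p(1,3) show "p \<in> ?pt ` Z"
        by (intro image_eqI[of _ _ "x / of_real \<beta>"])
          (auto simp: X_eq Z_def f_def poly_line_restriction)
    next
      fix p assume "p \<in> ?pt ` Z"
      then obtain r where r: "p = ?pt r" "poly f r = 0" by (auto simp: Z_def)
      then have "r \<in> \<real>" using real_root[OF line] by (simp add: f_def)
      with r show "p \<in> R"
        by (auto simp: R_def line_through_origin_def X_eq f_def poly_line_restriction)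
    qed
    moreover have "inj ?pt"
      using \<beta> by (intro injI) simp
    moreover have "affine_point (?pt r) = proj_point (line_vec \<alpha> \<beta> r 1)" for r
      by (simp add: affine_point_def line_vec_def)
    ultimately have sum: "(\<Sum>p\<in>R. intersection_mult X (proj_line_through_origin \<alpha> \<beta>) (affine_point p)) = degree f"
      using sum_intersection_mult_affine[OF line, of X] nonzero[OF line]
      by (simp add: sum.reindex inj_on_subset Z_def f_def D_def)
    \<comment> \<open>For \<open>\<beta> \<noteq> 0\<close> the top term of \<open>T (a + 1) (\<beta> r)\<close> survives, so no intersection is at infinity.\<close>
    have "f = smult c (pcompose (chebyshev_T (a + 1)) [:0, of_real \<beta>:] - pcompose (chebyshev_T a) [:0, of_real \<alpha>:])"
      by (rule poly_ext) (simp add: f_def poly_line_restriction c F_def eval2_chebyshev_eq poly_pcompose mult.commute)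
    then have "coeff f (a + 1) = c * (lead_coeff (chebyshev_T (a + 1)) * of_real \<beta> ^ (a + 1))"
      by (simp add: coeff_pcompose_linear degree_chebyshev_T coeff_eq_0)
    then have "coeff f (a + 1) \<noteq> 0"
      using c(1) \<beta> chebyshev_T_nonzero[of "a + 1"] by simp
    then have "degree f = a + 1"
      using degree_line_restriction_le[of \<alpha> \<beta> D] deg by (intro antisym le_degree) (auto simp: f_def)
    moreover have "finite Z"
      using poly_roots_finite nonzero[OF line] by (auto simp: Z_def f_def)
    ultimately show ?thesis
      using sum \<open>R = ?pt ` Z\<close> by simp
  qed
  show ?thesis
    using deg hyperbolic affine by (simp add: curve_degree_def D_def)
qed

end
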